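(* Every topological group is topologically isomorphic to a subgroup (with the subspace topology) of a duoseparable topological group.
   Context: A topological group $G$ is duoseparable if it contains a countable subset $S$ such that $G=SUS$ for every neighborhood $U\subseteq G$ of the unit, where $AB=\{ab:a\in A,\ b\in B\}$. *)

theory Defs
  imports "HOL-Analysis.Analysis" "HOL-Algebra.Coset"
begin

text \<open>No separation axiom is imposed on topological groups.\<close>

locale topological_group = group G for G (structure) +
  fixes T :: "'a topology"
  assumes topspace_eq_carrier: "topspace T = carrier G"
    and continuous_mult: "continuous_map (prod_topology T T) T (\<lambda>(x, y). x \<otimes> y)"
    and continuous_inv: "continuous_map T T (\<lambda>x. inv x)"

text \<open>A neighborhood of the unit is a set containing the unit in its interior; it need not be open.\<close>

definition duoseparable :: "('a, 'm) monoid_scheme \<Rightarrow> 'a topology \<Rightarrow> bool"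
  where "duoseparable G T \<longleftrightarrow>
    (\<exists>S \<subseteq> carrier G. countable S \<and>
      (\<forall>U \<subseteq> carrier G. \<one>\<^bsub>G\<^esub> \<in> T interior_of U \<longrightarrow>
        carrier G = S <#>\<^bsub>G\<^esub> U <#>\<^bsub>G\<^esub> S))"

definition topologically_isomorphic ::
    "('a, 'm) monoid_scheme \<Rightarrow> 'a topology \<Rightarrow> ('b, 'n) monoid_scheme \<Rightarrow> 'b topology \<Rightarrow> bool"
  where "topologically_isomorphic G T H T' \<longleftrightarrow>
    (\<exists>\<phi>. \<phi> \<in> iso G H \<and> homeomorphic_map T T' \<phi>)"

text \<open>
  HOL cannot quantify existentially over types, so the type carrying the ambient group has to
  be named. Finite words over countably many copies of the type of \<open>G\<close> lose no generality:
  let \<open>H\<close> be a duoseparable topological group on any type, witnessed by a countable set \<open>S\<close>, with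
  a subgroup \<open>K\<close> topologically isomorphic to \<open>G\<close>. Let \<open>H'\<close> be the subgroup generated by \<open>K \<union> S\<close>,
  with the subspace topology. If \<open>h = s u t\<close> with \<open>h \<in> H'\<close> and \<open>s, t \<in> S\<close>, then
  \<open>u = inv s h inv t\<close> lies in \<open>H'\<close>, so \<open>S\<close> witnesses that \<open>H'\<close> is duoseparable. Every element of
  \<open>H'\<close> is the value of a word in \<open>K\<close>, \<open>S\<close> and the inverses of \<open>S\<close>, so \<open>H'\<close> injects into the type below.
\<close>

type_synonym 'a ambient = "(nat \<times> 'a) list"

end

theory Submission
  imports Defs
begin

text \<open>
  Let \<open>L\<close> be the group of finitely supported functions from the integers to \<open>G\<close> with the topology
  of pointwise convergence. The shift is a homeomorphic automorphism \<open>\<alpha>\<close> of \<open>L\<close> with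
  \<open>\<alpha>\<^sup>n f \<longlonglongrightarrow> \<one>\<close> for every \<open>f\<close>. Hence in the semidirect product of \<open>L\<close> with the discrete
  infinite cyclic group generated by a letter \<open>t\<close> acting as \<open>\<alpha>\<close>, every element
  \<open>f t\<^sup>k = t\<^sup>-\<^sup>n (\<alpha>\<^sup>n f) t\<^sup>n\<^sup>+\<^sup>k\<close> lies in \<open>S U S\<close> with \<open>S\<close> the powers of \<open>t\<close>, for any
  neighborhood \<open>U\<close> of the unit. The functions supported at \<open>0\<close> form a copy of \<open>G\<close>.
\<close>

section \<open>Transport of structure along a bijection\<close>

text \<open>The construction naturally lives on functions paired with integers; this lemma moves it
  to the prescribed type \<open>'a ambient\<close>. Operations and topology are carried to the image
  of \<open>e\<close> through the inverse \<open>d\<close>, so \<open>e\<close> becomes an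
  isomorphism and a homeomorphism by construction.\<close>

lemma topological_group_transport:
  fixes e :: "'a \<Rightarrow> 'b" and G :: "('a, 'm) monoid_scheme" (structure)
  assumes "topological_group G T" and inj: "inj_on e (carrier G)"
  obtains H :: "'b monoid" and T' where
    "topological_group H T'" "e \<in> iso G H" "homeomorphic_map T T' e"
proof -
  interpret topological_group G T by fact
  define d where "d = inv_into (carrier G) e"
  have de [simp]: "d (e x) = x" if "x \<in> carrier G" for x
    using inj that by (simp add: d_def)
  define H where "H = \<lparr>carrier = e ` carrier G, monoid.mult = (\<lambda>a b. e (d a \<otimes> d b)), one = e \<one>\<rparr>"
  define T' where "T' = pullback_topology (e ` carrier G) d T"
  have carrier_H: "carrier H = e ` carrier G"
    by (simp add: H_def)
  have iso: "e \<in> iso G H"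
    using inj by (auto simp: iso_def hom_def bij_betw_def H_def)
  have "group H"
    using iso_imp_img_group[OF iso] by (simp add: H_def)
  interpret H: group H by fact
  interpret e: group_hom G H e
    using iso by (unfold_locales) (auto simp: iso_def)
  have topT': "topspace T' = carrier H"
    by (auto simp: T'_def topspace_pullback_topology carrier_H topspace_eq_carrier)
  have d: "continuous_map T' T d"
    using continuous_map_pullback[OF continuous_map_id[of T], of "e ` carrier G" d]
    by (simp add: T'_def)
  have e: "continuous_map T T' e"
    unfolding T'_def
  \<comment> \<open>Continuity into a pullback topology is tested after composing with
    \<open>d\<close>, and \<open>d \<circ> e\<close> is the identity on the carrier.\<close>
  proof (rule continuous_map_pullback')
    show "continuous_map T T (d \<circ> e)"
      by (rule continuous_map_eq[OF continuous_map_id]) (auto simp: topspace_eq_carrier)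
  qed (auto simp: topspace_eq_carrier)
  have homeo: "homeomorphic_maps T T' e d"
    using d e by (auto simp: homeomorphic_maps_def topspace_eq_carrier topT' carrier_H)
  have "topological_group H T'"
  proof
    \<comment> \<open>The product in \<open>H\<close> decodes both factors, multiplies in
      \<open>G\<close> and encodes again; each of the three maps is continuous.\<close>
    have "continuous_map (prod_topology T' T') T' (e \<circ> (\<lambda>(x, y). x \<otimes> y) \<circ> (\<lambda>(a, b). (d a, d b)))"
      using d by (intro continuous_map_compose[OF _ continuous_map_compose[OF continuous_mult e]])
        (simp add: continuous_map_prod_top)
    then show "continuous_map (prod_topology T' T') T' (\<lambda>(x, y). x \<otimes>\<^bsub>H\<^esub> y)"
      by (rule continuous_map_eq) (auto simp: topT' carrier_H)
    have "continuous_map T' T' (e \<circ> (\<lambda>x. inv x) \<circ> d)"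
      by (intro continuous_map_compose[OF d continuous_map_compose[OF continuous_inv e]])
    then show "continuous_map T' T' (\<lambda>x. inv\<^bsub>H\<^esub> x)"
    proof (rule continuous_map_eq)
      fix x assume "x \<in> topspace T'"
      then obtain y where "y \<in> carrier G" "x = e y"
        by (auto simp: topT' carrier_H)
      then show "(e \<circ> (\<lambda>x. inv x) \<circ> d) x = inv\<^bsub>H\<^esub> x"
        by simp
    qed
  qed (use topT' in auto)
  with iso homeo show ?thesis
    by (intro that) (auto simp: homeomorphic_map_maps)
qed

text \<open>The image of a witness is again a witness: a neighborhood in \<open>H\<close> is pulled
  back to \<open>G\<close>, factored there, and the factorization is mapped forward by
  \<open>e\<close>.\<close>

lemma duoseparable_transport:
  assumes "topological_group G T" "topological_group H T'"
    and iso: "e \<in> iso G H" and homeo: "homeomorphic_map T T' e" and duo: "duoseparable G T"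
  shows "duoseparable H T'"
proof -
  interpret G: topological_group G T by fact
  interpret H: topological_group H T' by fact
  interpret e: group_hom G H e
    using iso by (unfold_locales) (auto simp: iso_def)
  have surj: "e ` carrier G = carrier H"
    using iso by (auto simp: iso_def bij_betw_def)
  from duo obtain S where S: "S \<subseteq> carrier G" "countable S"
    and SUS: "\<And>U. \<lbrakk>U \<subseteq> carrier G; \<one>\<^bsub>G\<^esub> \<in> T interior_of U\<rbrakk> \<Longrightarrow>
      carrier G = S <#>\<^bsub>G\<^esub> U <#>\<^bsub>G\<^esub> S"
    unfolding duoseparable_def by metis
  have "carrier H = e ` S <#>\<^bsub>H\<^esub> U <#>\<^bsub>H\<^esub> e ` S"
    if U: "U \<subseteq> carrier H" "\<one>\<^bsub>H\<^esub> \<in> T' interior_of U" for U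
  proof
    show "e ` S <#>\<^bsub>H\<^esub> U <#>\<^bsub>H\<^esub> e ` S \<subseteq> carrier H"
      using S(1) U(1) by (intro H.set_mult_closed) auto
  next
    \<comment> \<open>\<open>U\<close> need not be open, so its preimage \<open>V\<close> is seen to
      be a neighborhood through \<open>W\<close>, the open preimage of the interior of
      \<open>U\<close>.\<close>
    define V where "V = {x \<in> carrier G. e x \<in> U}"
    define W where "W = {x \<in> topspace T. e x \<in> T' interior_of U}"
    have "openin T W" unfolding W_def
      using homeo by (intro openin_continuous_map_preimage[OF homeomorphic_imp_continuous_map]) auto
    moreover have "W \<subseteq> V"
      using interior_of_subset[of T' U] by (auto simp: V_def W_def G.topspace_eq_carrier)
    moreover have "\<one>\<^bsub>G\<^esub> \<in> W"
      using U(2) by (simp add: W_def G.topspace_eq_carrier)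
    ultimately have "\<one>\<^bsub>G\<^esub> \<in> T interior_of V"
      by (auto simp: interior_of_def)
    then have *: "carrier G = S <#>\<^bsub>G\<^esub> V <#>\<^bsub>G\<^esub> S"
      by (intro SUS) (auto simp: V_def)
    show "carrier H \<subseteq> e ` S <#>\<^bsub>H\<^esub> U <#>\<^bsub>H\<^esub> e ` S"
    proof
      fix y assume "y \<in> carrier H"
      then obtain x where x: "x \<in> carrier G" "y = e x"
        using surj by auto
      from x(1)[unfolded *] obtain s v t where "s \<in> S" "v \<in> V" "t \<in> S"
        and "x = s \<otimes>\<^bsub>G\<^esub> v \<otimes>\<^bsub>G\<^esub> t"
        by (auto simp: set_mult_def)
      moreover from this have "y = e s \<otimes>\<^bsub>H\<^esub> e v \<otimes>\<^bsub>H\<^esub> e t"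
        using S(1) x(2) by (auto simp: V_def subset_iff)
      ultimately show "y \<in> e ` S <#>\<^bsub>H\<^esub> U <#>\<^bsub>H\<^esub> e ` S"
        by (auto simp: set_mult_def V_def)
    qed
  qed
  moreover have "e ` S \<subseteq> carrier H" "countable (e ` S)"
    using S by auto
  ultimately show ?thesis
    unfolding duoseparable_def by blast
qed

text \<open>The product with a discrete space is a disjoint union of open copies of
  \<open>X\<close>, so continuity may be checked on each slice separately.\<close>

lemma continuous_map_prod_discrete:
  assumes "\<And>d. d \<in> D \<Longrightarrow> continuous_map X Y (f d)"
  shows "continuous_map (prod_topology X (discrete_topology D)) Y (\<lambda>(x, d). f d x)"
  unfolding continuous_map_def
proof (intro conjI allI impI)
  show "(\<lambda>(x, d). f d x) \<in> topspace (prod_topology X (discrete_topology D)) \<rightarrow> topspace Y"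
    using assms by (auto simp: continuous_map_def)
next
  fix U assume U: "openin Y U"
  have "{p \<in> topspace (prod_topology X (discrete_topology D)). (case p of (x, d) \<Rightarrow> f d x) \<in> U} =
      (\<Union>d\<in>D. {x \<in> topspace X. f d x \<in> U} \<times> {d})"
    by auto
  moreover have "openin (prod_topology X (discrete_topology D)) \<dots>"
    using U assms
    by (intro openin_Union ballI)
      (auto simp: openin_prod_Times_iff intro!: openin_continuous_map_preimage[of X Y])
  ultimately show "openin (prod_topology X (discrete_topology D))
      {p \<in> topspace (prod_topology X (discrete_topology D)). (case p of (x, d) \<Rightarrow> f d x) \<in> U}"
    by simp
qed

section \<open>The restricted wreath product of \<open>G\<close> by the integers\<close>

definition finsupp_fun :: "('a, 'm) monoid_scheme \<Rightarrow> (int \<Rightarrow> 'a) set"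
  where "finsupp_fun G = {f. range f \<subseteq> carrier G \<and> finite {i. f i \<noteq> \<one>\<^bsub>G\<^esub>}}"

text \<open>The pair \<open>(f, k)\<close> stands for \<open>f t\<^sup>k\<close>, where \<open>t f t\<^sup>-\<^sup>1\<close> is \<open>\<lambda>i. f (i - 1)\<close>.\<close>

definition wreath :: "('a, 'm) monoid_scheme \<Rightarrow> ((int \<Rightarrow> 'a) \<times> int) monoid"
  where "wreath G = \<lparr>carrier = finsupp_fun G \<times> UNIV,
    monoid.mult = (\<lambda>(f, m) (g, n). (\<lambda>i. f i \<otimes>\<^bsub>G\<^esub> g (i - m), m + n)),
    one = (\<lambda>i. \<one>\<^bsub>G\<^esub>, 0)\<rparr>"

definition wreath_topology ::
    "('a, 'm) monoid_scheme \<Rightarrow> 'a topology \<Rightarrow> ((int \<Rightarrow> 'a) \<times> int) topology"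
  where "wreath_topology G T = prod_topology
    (subtopology (product_topology (\<lambda>_. T) UNIV) (finsupp_fun G)) (discrete_topology UNIV)"

lemma finite_shift:
  fixes m :: int
  assumes "finite {i. P i}"
  shows "finite {i. P (i - m)}"
  using finite_vimageI[OF assms, of "\<lambda>i. i - m"] by (simp add: inj_on_def vimage_def)

context topological_group
begin

lemma finsupp_fun_closed [simp]: "f \<in> finsupp_fun G \<Longrightarrow> f i \<in> carrier G"
  by (auto simp: finsupp_fun_def)

lemma finsupp_fun_one [simp]: "(\<lambda>i. \<one>) \<in> finsupp_fun G"
  by (auto simp: finsupp_fun_def)

lemma finsupp_fun_single: "x \<in> carrier G \<Longrightarrow> (\<lambda>i. if i = k then x else \<one>) \<in> finsupp_fun G"
  by (auto simp: finsupp_fun_def)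

lemma finsupp_fun_shift: "f \<in> finsupp_fun G \<Longrightarrow> (\<lambda>i. f (i - m)) \<in> finsupp_fun G"
  using finite_shift[of "\<lambda>i. f i \<noteq> \<one>" m] by (auto simp: finsupp_fun_def)

lemma finsupp_fun_mult:
  assumes "f \<in> finsupp_fun G" "g \<in> finsupp_fun G"
  shows "(\<lambda>i. f i \<otimes> g i) \<in> finsupp_fun G"
proof -
  have "{i. f i \<otimes> g i \<noteq> \<one>} \<subseteq> {i. f i \<noteq> \<one>} \<union> {i. g i \<noteq> \<one>}"
    by auto
  then show ?thesis
    using assms by (auto simp: finsupp_fun_def intro: finite_subset)
qed

lemma finsupp_fun_inv:
  assumes "f \<in> finsupp_fun G"
  shows "(\<lambda>i. inv f i) \<in> finsupp_fun G"
proof -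
  have "{i. inv f i \<noteq> \<one>} \<subseteq> {i. f i \<noteq> \<one>}"
    by auto
  then show ?thesis
    using assms by (auto simp: finsupp_fun_def intro: finite_subset)
qed

lemma carrier_wreath: "carrier (wreath G) = finsupp_fun G \<times> UNIV"
  by (simp add: wreath_def)

lemma group_wreath: "group (wreath G)"
proof (rule groupI)
  fix x assume "x \<in> carrier (wreath G)"
  then obtain f m where x: "x = (f, m)" "f \<in> finsupp_fun G"
    by (auto simp: wreath_def)
  \<comment> \<open>The inverse of \<open>f t^m\<close> is \<open>t^(-m)\<close> times the pointwise
    inverse of \<open>f\<close>; moving the power of \<open>t\<close> to the right shifts the
    function by \<open>-m\<close>, whence the argument \<open>i + m\<close>.\<close>
  show "\<exists>y\<in>carrier (wreath G). y \<otimes>\<^bsub>wreath G\<^esub> x = \<one>\<^bsub>wreath G\<^esub>"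
    using x finsupp_fun_shift[OF finsupp_fun_inv[OF x(2)], of "- m"]
    by (intro bexI[of _ "(\<lambda>i. inv f (i + m), - m)"]) (auto simp: wreath_def)
qed (auto simp: wreath_def m_assoc diff_diff_add intro!: finsupp_fun_mult finsupp_fun_shift)

lemma inv_wreath:
  assumes "f \<in> finsupp_fun G"
  shows "inv\<^bsub>wreath G\<^esub> (f, m) = (\<lambda>i. inv f (i + m), - m)"
proof (rule group.inv_equality[OF group_wreath])
  show "(\<lambda>i. inv f (i + m), - m) \<in> carrier (wreath G)"
    using finsupp_fun_shift[OF finsupp_fun_inv[OF assms], of "- m"] by (simp add: wreath_def)
qed (use assms in \<open>auto simp: wreath_def\<close>)

section \<open>Continuity of the wreath product operations\<close>

lemma topspace_wreath: "topspace (wreath_topology G T) = carrier (wreath G)"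
  by (auto simp: wreath_topology_def wreath_def topspace_eq_carrier PiE_def)

lemma continuous_map_wreath_coordinate:
  "continuous_map (wreath_topology G T) T (\<lambda>x. fst x i)"
proof -
  have "continuous_map (subtopology (product_topology (\<lambda>_. T) UNIV) (finsupp_fun G)) T (\<lambda>f. f i)"
    by (intro continuous_map_from_subtopology continuous_map_product_projection) simp
  from continuous_map_compose[OF continuous_map_fst this] show ?thesis
    unfolding wreath_topology_def o_def .
qed

lemma continuous_map_wreath_snd:
  "continuous_map (wreath_topology G T) (discrete_topology UNIV) snd"
  unfolding wreath_topology_def by (rule continuous_map_snd)

lemma continuous_map_into_wreath:
  assumes "\<And>i. continuous_map X T (\<lambda>x. f x i)"
    and "\<And>x. x \<in> topspace X \<Longrightarrow> f x \<in> finsupp_fun G"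
    and "continuous_map X (discrete_topology UNIV) k"
  shows "continuous_map X (wreath_topology G T) (\<lambda>x. (f x, k x))"
  unfolding wreath_topology_def
  using assms by (auto simp: continuous_map_pairwise o_def continuous_map_in_subtopology
      continuous_map_componentwise_UNIV)

text \<open>Multiplication and inversion read a coordinate whose index depends on the point itself.
  Since indices form a discrete space, evaluation is jointly continuous in function and
  index.\<close>

lemma continuous_map_wreath_shifted_coordinate:
  assumes "continuous_map X (wreath_topology G T) f" "continuous_map X (discrete_topology UNIV) k"
  shows "continuous_map X T (\<lambda>x. fst (f x) (k x))"
proof -
  have "continuous_map X (prod_topology (wreath_topology G T) (discrete_topology UNIV))
      (\<lambda>x. (f x, k x))"
    using assms by (simp add: continuous_map_pairwise o_def)
  from continuous_map_compose[OF this continuous_map_prod_discrete,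
      OF continuous_map_wreath_coordinate]
  show ?thesis
    by (simp add: o_def)
qed

lemma topological_group_wreath: "topological_group (wreath G) (wreath_topology G T)"
proof -
  let ?W = "wreath_topology G T"
  have discrete: "continuous_map X (discrete_topology UNIV) (\<lambda>x. h (k x))"
    if "continuous_map X (discrete_topology UNIV) k"
    for X :: "'z topology" and k :: "'z \<Rightarrow> 'y" and h :: "'y \<Rightarrow> 'x"
    using continuous_map_compose[OF that, of "discrete_topology UNIV" h] by (simp add: o_def)
  interpret W: group "wreath G"
    by (rule group_wreath)
  show ?thesis
  proof
    let ?P = "prod_topology ?W ?W"
    have s1: "continuous_map ?P (discrete_topology UNIV) (\<lambda>p. snd (fst p))"
      using continuous_map_compose[OF continuous_map_fst continuous_map_wreath_snd] by (simp add: o_def)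
    have s2: "continuous_map ?P (discrete_topology UNIV) (\<lambda>p. snd (snd p))"
      using continuous_map_compose[OF continuous_map_snd continuous_map_wreath_snd] by (simp add: o_def)
    have "continuous_map ?P (prod_topology (discrete_topology UNIV) (discrete_topology UNIV))
        (\<lambda>p. (snd (fst p), snd (snd p)))"
      using s1 s2 by (simp add: continuous_map_pairwise o_def)
    \<comment> \<open>A product of discrete spaces is discrete, so every function of the two shift
      components, in particular their sum, is continuous.\<close>
    then have s12: "continuous_map ?P (discrete_topology UNIV) (\<lambda>p. (snd (fst p), snd (snd p)))"
      by (simp flip: prod_topology_discrete_topology)
    have "continuous_map ?P ?W
        (\<lambda>p. (\<lambda>i. fst (fst p) i \<otimes> fst (snd p) (i - snd (fst p)), snd (fst p) + snd (snd p)))"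
    proof (rule continuous_map_into_wreath)
      fix i
      have "continuous_map ?P T (\<lambda>p. fst (fst p) i)"
        using continuous_map_compose[OF continuous_map_fst continuous_map_wreath_coordinate]
        by (simp add: o_def)
      moreover have "continuous_map ?P T (\<lambda>p. fst (snd p) (i - snd (fst p)))"
        using discrete[OF s1, of "\<lambda>m. i - m"]
        by (rule continuous_map_wreath_shifted_coordinate[OF continuous_map_snd])
      ultimately have "continuous_map ?P (prod_topology T T)
          (\<lambda>p. (fst (fst p) i, fst (snd p) (i - snd (fst p))))"
        by (simp add: continuous_map_pairwise o_def)
      from continuous_map_compose[OF this continuous_mult]
      show "continuous_map ?P T (\<lambda>p. fst (fst p) i \<otimes> fst (snd p) (i - snd (fst p)))"
        by (simp add: o_def)
    next
      fix p assume "p \<in> topspace ?P"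
      then show "(\<lambda>i. fst (fst p) i \<otimes> fst (snd p) (i - snd (fst p))) \<in> finsupp_fun G"
        by (auto simp: topspace_wreath wreath_def intro!: finsupp_fun_mult finsupp_fun_shift)
    next
      show "continuous_map ?P (discrete_topology UNIV) (\<lambda>p. snd (fst p) + snd (snd p))"
        using discrete[OF s12, of "\<lambda>(m, n). m + n"] by simp
    qed
    then show "continuous_map ?P ?W (\<lambda>(x, y). x \<otimes>\<^bsub>wreath G\<^esub> y)"
      by (rule continuous_map_eq) (auto simp: wreath_def)
  next
    have "continuous_map ?W ?W (\<lambda>x. (\<lambda>i. inv fst x (i + snd x), - snd x))"
    proof (rule continuous_map_into_wreath)
      fix i
      have "continuous_map ?W T (\<lambda>x. fst x (i + snd x))"
        using discrete[OF continuous_map_wreath_snd, of "\<lambda>m. i + m"]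
        by (rule continuous_map_wreath_shifted_coordinate[OF continuous_map_id[unfolded id_def]])
      from continuous_map_compose[OF this continuous_inv]
      show "continuous_map ?W T (\<lambda>x. inv fst x (i + snd x))"
        by (simp add: o_def)
    next
      fix x assume "x \<in> topspace ?W"
      then show "(\<lambda>i. inv fst x (i + snd x)) \<in> finsupp_fun G"
        using finsupp_fun_shift[OF finsupp_fun_inv, of "fst x" "- snd x"]
        by (auto simp: topspace_wreath wreath_def)
    qed (rule discrete[OF continuous_map_wreath_snd])
    then show "continuous_map ?W ?W (\<lambda>x. inv\<^bsub>wreath G\<^esub> x)"
      by (rule continuous_map_eq) (auto simp: topspace_wreath carrier_wreath inv_wreath)
  qed (rule topspace_wreath)
qed

section \<open>Neighborhoods of the unit and duoseparability\<close>

text \<open>A basic open set of the product topology constrains only finitely many coordinates;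
  these make up \<open>F\<close>. This is all that duoseparability needs to know about
  \<open>U\<close>.\<close>

lemma neighborhood_wreath_finite:
  assumes "\<one>\<^bsub>wreath G\<^esub> \<in> wreath_topology G T interior_of U"
  obtains F where "finite F"
    "\<And>f. \<lbrakk>f \<in> finsupp_fun G; \<And>i. i \<in> F \<Longrightarrow> f i = \<one>\<rbrakk> \<Longrightarrow> (f, 0) \<in> U"
proof -
  obtain V where V: "openin (wreath_topology G T) V" "\<one>\<^bsub>wreath G\<^esub> \<in> V" "V \<subseteq> U"
    using assms by (auto simp: interior_of_def)
  from V(2) have "(\<lambda>i. \<one>, 0) \<in> V"
    by (simp add: wreath_def)
  with V(1) obtain A B where A: "openin (subtopology (product_topology (\<lambda>_. T) UNIV) (finsupp_fun G)) A"
    and AB: "(\<lambda>i. \<one>) \<in> A" "0 \<in> B" "A \<times> B \<subseteq> V"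
    unfolding wreath_topology_def openin_prod_topology_alt by metis
  from A obtain C where C: "openin (product_topology (\<lambda>_. T) UNIV) C" "A = C \<inter> finsupp_fun G"
    by (auto simp: openin_subtopology)
  with AB have "(\<lambda>i. \<one>) \<in> C"
    by auto
  with C(1) obtain X where X: "finite {i. X i \<noteq> topspace T}" "(\<lambda>i. \<one>) \<in> Pi\<^sub>E UNIV X" "Pi\<^sub>E UNIV X \<subseteq> C"
    unfolding openin_product_topology_alt by auto
  show ?thesis
  proof (rule that[OF X(1)])
    fix f assume f: "f \<in> finsupp_fun G" "\<And>i. i \<in> {i. X i \<noteq> topspace T} \<Longrightarrow> f i = \<one>"
    \<comment> \<open>On constrained coordinates \<open>f\<close> agrees with the unit, which lies
      in the box; on the others \<open>X i\<close> is the whole space.\<close>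
    have "f i \<in> X i" for i
      using f X(2) by (cases "X i = topspace T") (auto simp: topspace_eq_carrier)
    then have "f \<in> C"
      using X(3) by auto
    then show "(f, 0) \<in> U"
      using f(1) C(2) AB V(3) by auto
  qed
qed

lemma duoseparable_wreath: "duoseparable (wreath G) (wreath_topology G T)"
proof -
  interpret W: group "wreath G"
    by (rule group_wreath)
  define S :: "((int \<Rightarrow> 'a) \<times> int) set" where "S = range (\<lambda>n. (\<lambda>i. \<one>, n))"
  have S: "S \<subseteq> carrier (wreath G)" "countable S"
    by (auto simp: S_def wreath_def)
  have "carrier (wreath G) = S <#>\<^bsub>wreath G\<^esub> U <#>\<^bsub>wreath G\<^esub> S"
    if U: "U \<subseteq> carrier (wreath G)" "\<one>\<^bsub>wreath G\<^esub> \<in> wreath_topology G T interior_of U" for U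
  proof
    show "S <#>\<^bsub>wreath G\<^esub> U <#>\<^bsub>wreath G\<^esub> S \<subseteq> carrier (wreath G)"
      using S(1) U(1) by (intro W.set_mult_closed)
  next
    obtain F where F: "finite F"
      "\<And>f. \<lbrakk>f \<in> finsupp_fun G; \<And>i. i \<in> F \<Longrightarrow> f i = \<one>\<rbrakk> \<Longrightarrow> (f, 0) \<in> U"
      using neighborhood_wreath_finite[OF U(2)] by blast
    show "carrier (wreath G) \<subseteq> S <#>\<^bsub>wreath G\<^esub> U <#>\<^bsub>wreath G\<^esub> S"
    proof
      fix x assume "x \<in> carrier (wreath G)"
      then obtain f k where x: "x = (f, k)" and f: "f \<in> finsupp_fun G"
        by (auto simp: wreath_def)
      then have "finite {i. f i \<noteq> \<one>}"
        by (simp add: finsupp_fun_def)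
      then have "finite ((\<lambda>(i, j). i - j) ` (F \<times> {i. f i \<noteq> \<one>}))"
        using F(1) by blast
      \<comment> \<open>Avoiding all differences between \<open>F\<close> and the support of
        \<open>f\<close> makes the support of the shift of \<open>f\<close> by \<open>n\<close>
        disjoint from \<open>F\<close>. Any \<open>n\<close> outside this finite set works, so no
        limit argument is required.\<close>
      then obtain n where n: "n \<notin> (\<lambda>(i, j). i - j) ` (F \<times> {i. f i \<noteq> \<one>})"
        using ex_new_if_finite infinite_UNIV_int by blast
      have "f (i - n) = \<one>" if "i \<in> F" for i
      proof (rule ccontr)
        assume "f (i - n) \<noteq> \<one>"
        with that have "(i, i - n) \<in> F \<times> {i. f i \<noteq> \<one>}"
          by simp
        from imageI[OF this, of "\<lambda>(i, j). i - j"] n show False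
          by simp
      qed
      then have "(\<lambda>i. f (i - n), 0) \<in> U"
        using f by (intro F(2) finsupp_fun_shift)
      moreover have "(\<lambda>i. \<one>, - n) \<in> S" "(\<lambda>i. \<one>, n + k) \<in> S"
        by (auto simp: S_def)
      \<comment> \<open>Left multiplication by \<open>t^(-n)\<close> undoes the shift and leaves the
        exponent \<open>-n\<close>, which the last factor \<open>t^(n+k)\<close> corrects to
        \<open>k\<close>.\<close>
      moreover have "x = (\<lambda>i. \<one>, - n) \<otimes>\<^bsub>wreath G\<^esub> (\<lambda>i. f (i - n), 0) \<otimes>\<^bsub>wreath G\<^esub> (\<lambda>i. \<one>, n + k)"
        using f by (simp add: x wreath_def)
      ultimately show "x \<in> S <#>\<^bsub>wreath G\<^esub> U <#>\<^bsub>wreath G\<^esub> S"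
        by (auto simp only: set_mult_def)
    qed
  qed
  with S show ?thesis
    unfolding duoseparable_def by blast
qed

section \<open>The copy of \<open>G\<close> at coordinate zero\<close>

definition wreath_emb :: "'a \<Rightarrow> (int \<Rightarrow> 'a) \<times> int"
  where "wreath_emb x = (\<lambda>i. if i = 0 then x else \<one>, 0)"

lemma wreath_emb_mon: "wreath_emb \<in> mon G (wreath G)"
proof -
  have "wreath_emb \<in> hom G (wreath G)"
    by (auto simp: hom_def wreath_def wreath_emb_def finsupp_fun_single fun_eq_iff)
  moreover have "inj_on wreath_emb (carrier G)"
    by (auto simp: inj_on_def wreath_emb_def fun_eq_iff split: if_splits)
  ultimately show ?thesis
    by (simp add: mon_def)
qed

text \<open>Evaluation at coordinate \<open>0\<close> is a continuous left inverse, so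
  \<open>wreath_emb\<close> is a section and therefore an embedding.\<close>

lemma embedding_map_wreath_emb: "embedding_map T (wreath_topology G T) wreath_emb"
proof -
  have "continuous_map T T (\<lambda>x. if i = 0 then x else \<one>)" for i :: int
    by (cases "i = 0") (auto simp: topspace_eq_carrier)
  then have "continuous_map T (wreath_topology G T) wreath_emb"
    unfolding wreath_emb_def
    by (intro continuous_map_into_wreath) (auto simp: topspace_eq_carrier finsupp_fun_single)
  then have "retraction_maps (wreath_topology G T) T (\<lambda>x. fst x 0) wreath_emb"
    using continuous_map_wreath_coordinate[of 0] by (simp add: retraction_maps_def wreath_emb_def)
  then show ?thesis
    by (intro section_imp_embedding_map) (auto simp: section_map_def)
qed

end

section \<open>Encoding into the ambient type and conclusion\<close>

text \<open>A finitely supported function is determined by its nontrivial values together with their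
  indices, which fit into a finite list; one extra entry at the head records the integer.\<close>

lemma finsupp_fun_encoding:
  fixes G :: "('a, 'm) monoid_scheme"
  obtains e :: "(int \<Rightarrow> 'a) \<times> int \<Rightarrow> 'a ambient" where "inj_on e (finsupp_fun G \<times> UNIV)"
proof
  define supp where "supp f = {i. f i \<noteq> \<one>\<^bsub>G\<^esub>}" for f :: "int \<Rightarrow> 'a"
  define tail :: "(int \<Rightarrow> 'a) \<Rightarrow> 'a ambient" where
    "tail f = map (\<lambda>i. (int_encode i, f i)) (sorted_list_of_set (supp f))" for f
  define e :: "(int \<Rightarrow> 'a) \<times> int \<Rightarrow> 'a ambient" where
    \<comment> \<open>\<open>undefined\<close> only fills the second slot of the head, the same way
      in every code, so it does not affect injectivity.\<close>
    "e = (\<lambda>(f, k). (int_encode k, undefined) # tail f)"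
  have tail: "set (tail f) = {(int_encode i, f i) | i. f i \<noteq> \<one>\<^bsub>G\<^esub>}" if "f \<in> finsupp_fun G" for f
    using that by (auto simp: tail_def supp_def finsupp_fun_def)
  have agree: "f i = g i"
    if "f \<in> finsupp_fun G" "g \<in> finsupp_fun G" "tail f = tail g" "f i \<noteq> \<one>\<^bsub>G\<^esub>" for f g i
  proof -
    have "(int_encode i, f i) \<in> set (tail g)"
      using tail[OF that(1)] that(3,4) by auto
    then show ?thesis
      unfolding tail[OF that(2)] by (auto simp: int_encode_eq)
  qed
  \<comment> \<open>\<open>agree\<close> applied in both directions covers every index where
    \<open>f\<close> or \<open>g\<close> is nontrivial; elsewhere both equal the unit.\<close>
  have "f = g" if "f \<in> finsupp_fun G" "g \<in> finsupp_fun G" "tail f = tail g" for f g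
    using agree[OF that] agree[OF that(2,1) that(3)[symmetric]] by (metis ext)
  then show "inj_on e (finsupp_fun G \<times> UNIV)"
    by (auto simp: inj_on_def e_def int_encode_eq)
qed

text \<open>The ambient group is the encoded wreath product, and \<open>K\<close> is the image of
  \<open>G\<close> under \<open>wreath_emb\<close> followed by the encoding.\<close>

theorem corollary2:
  fixes G :: "('a, 'm) monoid_scheme" and T :: "'a topology"
  assumes "topological_group G T"
  shows "\<exists>(H :: 'a ambient monoid) T' K.
    topological_group H T' \<and> duoseparable H T' \<and> subgroup K H \<and>
    topologically_isomorphic G T (H\<lparr>carrier := K\<rparr>) (subtopology T' K)"
proof -
  interpret topological_group G T by fact
  obtain e :: "(int \<Rightarrow> 'a) \<times> int \<Rightarrow> 'a ambient" where "inj_on e (carrier (wreath G))"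
    using finsupp_fun_encoding[of G] by (auto simp: wreath_def)
  then obtain H :: "'a ambient monoid" and T' where H: "topological_group H T'"
    and e: "e \<in> iso (wreath G) H" "homeomorphic_map (wreath_topology G T) T' e"
    using topological_group_transport[OF topological_group_wreath] by metis
  interpret H: topological_group H T' by fact
  have "duoseparable H T'"
    using duoseparable_transport[OF topological_group_wreath H e duoseparable_wreath] .
  define \<phi> where "\<phi> = e \<circ> wreath_emb"
  have mon: "\<phi> \<in> mon G H"
    using wreath_emb_mon e(1) unfolding \<phi>_def
    by (intro mon_compose) (auto simp: iso_def mon_def bij_betw_def)
  then interpret \<phi>: group_hom G H \<phi>
    by unfold_locales (simp add: mon_def)
  have "embedding_map T T' \<phi>"
    using embedding_map_compose[OF embedding_map_wreath_emb] e(2) surjective_embedding_map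
    unfolding \<phi>_def by blast
  then have "homeomorphic_map T (subtopology T' (\<phi> ` carrier G)) \<phi>"
    by (simp add: embedding_map_def topspace_eq_carrier)
  moreover have "\<phi> \<in> iso G (H\<lparr>carrier := \<phi> ` carrier G\<rparr>)"
    using mon by (auto simp: mon_def iso_def hom_def bij_betw_def)
  ultimately have "topologically_isomorphic G T (H\<lparr>carrier := \<phi> ` carrier G\<rparr>)
      (subtopology T' (\<phi> ` carrier G))"
    unfolding topologically_isomorphic_def by blast
  with H \<open>duoseparable H T'\<close> \<phi>.img_is_subgroup show ?thesis
    by blast
qed

end
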